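(* For all $n\ge 2$ and $k\in[n]$, the map $\theta$ restricts to a bijection from $\mathcal{DU}_{n,k}$ onto $\mathcal{DU}'_{n,k}$, and $\theta(\pi)_2=\pi_2$ for every $\pi\in\mathcal{DU}_{n,k}$.
   Context: $[n]=\{1,\dots,n\}$. $\mathcal{DU}_n$ is the set of permutations $\pi=\pi_1\cdots\pi_n$ of $[n]$ with $\pi_1>\pi_2<\pi_3>\cdots$; $\mathcal{DU}_{n,k}$ is the subset with $\pi_1=k$; $\mathcal{DU}'_{n,k}$ is the set of $\pi\in\mathcal{DU}_n$ with $\pi_1-\pi_2=n+1-k$. For a permutation $\sigma$ of $[n]$, $\sigma\circ\pi$ is the word obtained by replacing each letter $\pi_i$ by $\sigma(\pi_i)$; the cycle $(c_1,c_2,\dots,c_r)$ is the permutation sending $c_1\mapsto c_2\mapsto\cdots\mapsto c_r\mapsto c_1$ and fixing all other elements. For $\pi\in\mathcal{DU}_{n,k}$ put $m=n-k+1+\pi_2$ and define: $\theta(\pi)=(m,m-1,\dots,k+1,k)\circ\pi$ if $k<m$; $\theta(\pi)=(m,m+1,\dots,k-1,k)\circ\pi$ if $k>m$; $\theta(\pi)=\pi$ if $k=m$. *)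

theory Defs
  imports Complex_Main "HOL-Combinatorics.Permutations" "HOL-Combinatorics.Cycles"
begin

text \<open>
  The word \<open>\<pi>\<^sub>1\<dots>\<pi>\<^sub>n\<close> is represented by the function \<open>i \<mapsto> \<pi>\<^sub>i\<close> on \<open>{1..n}\<close>, extended by the
  identity (\<open>permutes\<close>). Replacing each letter \<open>\<pi>\<^sub>i\<close> by \<open>\<sigma>(\<pi>\<^sub>i)\<close> is then function composition.
\<close>

definition DU :: "nat \<Rightarrow> (nat \<Rightarrow> nat) set" where
  "DU n = {\<pi>. \<pi> permutes {1..n} \<and>
     (\<forall>i\<in>{1..<n}. if odd i then \<pi> i > \<pi> (i + 1) else \<pi> i < \<pi> (i + 1))}"

definition DU_first :: "nat \<Rightarrow> nat \<Rightarrow> (nat \<Rightarrow> nat) set" where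
  "DU_first n k = {\<pi> \<in> DU n. \<pi> 1 = k}"

definition DU_diff :: "nat \<Rightarrow> nat \<Rightarrow> (nat \<Rightarrow> nat) set" where
  "DU_diff n k = {\<pi> \<in> DU n. int (\<pi> 1) - int (\<pi> 2) = int n + 1 - int k}"

text \<open>
  \<open>cycle_of_list [c\<^sub>1, \<dots>, c\<^sub>r]\<close> sends \<open>c\<^sub>1\<close> to \<open>c\<^sub>2\<close>, and so on up to \<open>c\<^sub>r\<close> to \<open>c\<^sub>1\<close>. The truncated
  subtraction \<open>n - k\<close> is exact for \<open>\<pi> \<in> DU n\<close> with \<open>n \<ge> 1\<close>, because then \<open>\<pi> 1 \<le> n\<close>.
\<close>

definition theta :: "nat \<Rightarrow> (nat \<Rightarrow> nat) \<Rightarrow> (nat \<Rightarrow> nat)" where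
  "theta n \<pi> =
     (let k = \<pi> 1; m = n - k + 1 + \<pi> 2 in
      if k < m then cycle_of_list (rev [k..<Suc m]) \<circ> \<pi>
      else if k > m then cycle_of_list [m..<Suc k] \<circ> \<pi>
      else \<pi>)"

end

theory Submission
  imports Defs
begin

text \<open>
  The cycle applied by \<open>\<theta>\<close> moves the value \<open>k = \<pi>\<^sub>1\<close> to \<open>m\<close> and is strictly increasing on the
  remaining values. Since both \<open>k\<close> and \<open>m\<close> exceed \<open>\<pi>\<^sub>2\<close>, it fixes \<open>\<pi>\<^sub>2\<close>, and the alternating pattern
  survives. As \<open>k = n - m + 1 + \<pi>\<^sub>2\<close> as well, \<open>\<theta>\<close> is an involution on \<open>\<D>\<U>\<^sub>n\<close>.
\<close>

text \<open>One closed form serves both cycles and the identity: at most one of the two shifting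
  ranges is nonempty, according to the order of \<open>k\<close> and \<open>m\<close>. Swapping
  \<open>k\<close> and \<open>m\<close> gives the inverse.\<close>

definition relocate :: "nat \<Rightarrow> nat \<Rightarrow> nat \<Rightarrow> nat" where
  "relocate k m x =
     (if x = k then m else if k < x \<and> x \<le> m then x - 1
      else if m \<le> x \<and> x < k then x + 1 else x)"

lemma relocate_source [simp]: "relocate k m k = m"
  by (simp add: relocate_def)

lemma relocate_below: "x < k \<Longrightarrow> x < m \<Longrightarrow> relocate k m x = x"
  by (simp add: relocate_def)

lemma relocate_inverse [simp]: "relocate m k (relocate k m x) = x"
  by (auto simp: relocate_def)

text \<open>Removing \<open>k\<close> leaves a gap into which the values between \<open>k\<close>
  and \<open>m\<close> shift by one, so their order is kept; only \<open>k\<close> itself jumps over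
  others.\<close>

lemma relocate_strict_mono_on: "strict_mono_on (- {k}) (relocate k m)"
  by (rule strict_mono_onI) (auto simp: relocate_def)

lemma relocate_permutes:
  assumes "k \<in> {a..b}" "m \<in> {a..b}"
  shows "relocate k m permutes {a..b}"
proof -
  have "relocate k m x = x" if "x \<notin> {a..b}" for x
    using assms that by (auto simp: relocate_def)
  moreover have "\<exists>!x. relocate k m x = y" for y
    by (metis relocate_inverse)
  ultimately show ?thesis
    by (simp add: permutes_def)
qed

text \<open>A cycle unfolds at the head of its list as a transposition composed with the cycle of
  the tail, hence downward induction on \<open>m\<close> with \<open>k\<close> fixed.\<close>

lemma cycle_of_list_upt:
  assumes "m \<le> k"
  shows "cycle_of_list [m..<Suc k] = relocate k m"
  using assms
proof (induction rule: inc_induct)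
  case base
  show ?case by (auto simp: relocate_def)
next
  case (step m)
  \<comment> \<open>Two leading entries must be exposed for this unfolding; \<open>upt_Suc\<close>
    would split the list at its other end.\<close>
  then have "[m..<Suc k] = m # Suc m # [Suc (Suc m)..<Suc k]"
    by (simp add: upt_conv_Cons del: upt_Suc)
  moreover have "[Suc m..<Suc k] = Suc m # [Suc (Suc m)..<Suc k]"
    using step by (simp add: upt_conv_Cons del: upt_Suc)
  ultimately have "cycle_of_list [m..<Suc k] = transpose m (Suc m) \<circ> relocate k (Suc m)"
    using step.IH by simp
  also have "\<dots> = relocate k m"
    using step.hyps by (auto simp: fun_eq_iff relocate_def transpose_def)
  finally show ?case .
qed

text \<open>The reversed list grows at its head as \<open>m\<close> increases, so here the induction
  goes upward.\<close>

lemma cycle_of_list_rev_upt: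
  assumes "k \<le> m"
  shows "cycle_of_list (rev [k..<Suc m]) = relocate k m"
  using assms
proof (induction rule: dec_induct)
  case base
  show ?case by (auto simp: relocate_def)
next
  case (step m)
  then have "cycle_of_list (rev [k..<Suc (Suc m)]) = transpose (Suc m) m \<circ> relocate k m"
    by simp
  also have "\<dots> = relocate k (Suc m)"
    using step.hyps by (auto simp: fun_eq_iff relocate_def transpose_def)
  finally show ?case .
qed

lemma theta_eq_relocate: "theta n \<pi> = relocate (\<pi> 1) (n - \<pi> 1 + 1 + \<pi> 2) \<circ> \<pi>"
proof -
  have "relocate k k = id" for k
    by (auto simp: relocate_def)
  then show ?thesis
    unfolding theta_def Let_def
    by (auto simp: cycle_of_list_upt cycle_of_list_rev_upt simp del: upt_Suc
        dest: order.strict_implies_order antisym_conv3)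
qed

text \<open>These bounds make \<open>n - \<pi> 1\<close> exact and place
  \<open>m = n - \<pi> 1 + 1 + \<pi> 2\<close> strictly above \<open>\<pi> 2\<close> and at most at
  \<open>n\<close>.\<close>

lemma DU_first_two:
  assumes "\<pi> \<in> DU n" "n \<ge> 2"
  shows "\<pi> 2 < \<pi> 1" "\<pi> 1 \<le> n" "1 \<le> \<pi> 2"
proof -
  have "\<pi> permutes {1..n}"
    and alt: "\<forall>i\<in>{1..<n}. if odd i then \<pi> i > \<pi> (i + 1) else \<pi> i < \<pi> (i + 1)"
    using assms(1) by (auto simp: DU_def)
  then have "\<pi> 1 \<in> {1..n}" "\<pi> 2 \<in> {1..n}"
    using assms(2) permutes_in_image by fastforce+
  then show "\<pi> 1 \<le> n" "1 \<le> \<pi> 2"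
    by auto
  show "\<pi> 2 < \<pi> 1"
    using alt[rule_format, of 1] assms(2) by (simp add: numeral_2_eq_2)
qed

lemma theta_1: "theta n \<pi> 1 = n - \<pi> 1 + 1 + \<pi> 2"
  by (simp add: theta_eq_relocate)

lemma theta_2: "\<pi> \<in> DU n \<Longrightarrow> n \<ge> 2 \<Longrightarrow> theta n \<pi> 2 = \<pi> 2"
  using DU_first_two[of \<pi> n] by (simp add: theta_eq_relocate relocate_below)

lemma theta_in_DU:
  assumes "\<pi> \<in> DU n" "n \<ge> 2"
  shows "theta n \<pi> \<in> DU n"
proof -
  define m where "m = n - \<pi> 1 + 1 + \<pi> 2"
  have perm: "\<pi> permutes {1..n}"
    and alt: "\<And>i. i \<in> {1..<n} \<Longrightarrow> if odd i then \<pi> i > \<pi> (i + 1) else \<pi> i < \<pi> (i + 1)"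
    using assms(1) unfolding DU_def by blast+
  note bounds = DU_first_two[OF assms]
  have theta: "theta n \<pi> = relocate (\<pi> 1) m \<circ> \<pi>"
    by (simp add: theta_eq_relocate m_def)
  have "relocate (\<pi> 1) m permutes {1..n}"
    using bounds by (intro relocate_permutes) (auto simp: m_def)
  then have "theta n \<pi> permutes {1..n}"
    unfolding theta using perm by (rule permutes_compose[rotated])
  moreover have "if odd i then theta n \<pi> i > theta n \<pi> (i + 1) else theta n \<pi> i < theta n \<pi> (i + 1)"
    if i: "i \<in> {1..<n}" for i
  proof (cases "i = 1")
    case True
    then show ?thesis
      using theta_1[of n \<pi>] theta_2[OF assms] by (simp add: numeral_2_eq_2)
  next
    case False
    \<comment> \<open>By injectivity the moved letter \<open>\<pi> 1\<close> occurs only in position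
      1, so every later comparison lies where \<open>relocate\<close> is increasing.\<close>
    have "\<pi> j \<in> - {\<pi> 1}" if "j \<noteq> 1" for j
      using that injD[OF permutes_inj[OF perm]] by auto
    then have "\<pi> i \<in> - {\<pi> 1}" "\<pi> (i + 1) \<in> - {\<pi> 1}"
      using False i by auto
    then show ?thesis
      using alt[OF i] relocate_strict_mono_on[of "\<pi> 1" m]
      unfolding theta comp_apply by (auto dest: strict_mono_onD split: if_splits)
  qed
  ultimately show ?thesis
    unfolding DU_def by blast
qed

lemma theta_theta:
  assumes "\<pi> \<in> DU n" "n \<ge> 2"
  shows "theta n (theta n \<pi>) = \<pi>"
proof -
  define m where "m = n - \<pi> 1 + 1 + \<pi> 2"
  \<comment> \<open>The relation \<open>\<pi> 1 + m = n + 1 + \<pi> 2\<close> is symmetric in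
    \<open>\<pi> 1\<close> and \<open>m\<close>, so the second application relocates
    \<open>m\<close> back to \<open>\<pi> 1\<close>.\<close>
  have "n - m + 1 + \<pi> 2 = \<pi> 1"
    using DU_first_two[OF assms] by (simp add: m_def)
  moreover have "theta n \<pi> = relocate (\<pi> 1) m \<circ> \<pi>"
    by (simp add: theta_eq_relocate m_def)
  moreover have "theta n (theta n \<pi>) =
      relocate (theta n \<pi> 1) (n - theta n \<pi> 1 + 1 + theta n \<pi> 2) \<circ> theta n \<pi>"
    by (rule theta_eq_relocate)
  ultimately show ?thesis
    using theta_1[of n \<pi>] theta_2[OF assms] by (simp add: m_def[symmetric] fun_eq_iff)
qed

theorem theorem6:
  fixes n k :: nat
  assumes "n \<ge> 2" and "k \<in> {1..n}"
  shows "bij_betw (theta n) (DU_first n k) (DU_diff n k)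
    \<and> (\<forall>\<pi> \<in> DU_first n k. theta n \<pi> 2 = \<pi> 2)"
proof (intro conjI ballI)
  show "theta n \<pi> 2 = \<pi> 2" if "\<pi> \<in> DU_first n k" for \<pi>
    using that assms(1) by (simp add: DU_first_def theta_2)
  show "bij_betw (theta n) (DU_first n k) (DU_diff n k)"
  proof (rule bij_betw_byWitness[where f' = "theta n"])
    show "\<forall>\<pi>\<in>DU_first n k. theta n (theta n \<pi>) = \<pi>"
      "\<forall>\<pi>\<in>DU_diff n k. theta n (theta n \<pi>) = \<pi>"
      using assms(1) by (auto simp: DU_first_def DU_diff_def theta_theta)
    show "theta n ` DU_first n k \<subseteq> DU_diff n k"
      using assms theta_1[of n] by (auto simp: DU_first_def DU_diff_def theta_2 theta_in_DU)
    show "theta n ` DU_diff n k \<subseteq> DU_first n k"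
    proof
      fix \<sigma>
      assume "\<sigma> \<in> theta n ` DU_diff n k"
      then obtain \<pi> where \<pi>: "\<pi> \<in> DU n" "int (\<pi> 1) - int (\<pi> 2) = int n + 1 - int k"
        and \<sigma>: "\<sigma> = theta n \<pi>"
        by (auto simp: DU_diff_def)
      \<comment> \<open>The difference condition on \<open>\<pi>\<close> says exactly that
        \<open>n - \<pi> 1 + 1 + \<pi> 2\<close> equals \<open>k\<close>.\<close>
      have "\<sigma> 1 = k"
        unfolding \<sigma> using DU_first_two[OF \<pi>(1) assms(1)] \<pi>(2) theta_1[of n \<pi>] by linarith
      then show "\<sigma> \<in> DU_first n k"
        using \<sigma> theta_in_DU[OF \<pi>(1) assms(1)] by (simp add: DU_first_def)
    qed
  qed
qed

end
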